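(* Let $(N,v)$ be a simple game such that the desirability relation $\succeq^v$ is total, i.e. for all $i,j\in N$, $i\succeq^v j$ or $j\succeq^v i$. Then $R_{\mathrm{LRM}}^v=R_{\mathrm{crit}}^v$. Moreover, the LRM and the criticality-based ranking are self-dual on $v$: $R_{\mathrm{LRM}}^v=R_{\mathrm{LRM}}^{v^*}$ and $R_{\mathrm{crit}}^v=R_{\mathrm{crit}}^{v^*}$, where $v^*$ is the dual game of $v$.
   Context: A simple game on $N=\{1,\dots,n\}$ is a function $v:2^N\to\{0,1\}$ with $v(\varnothing)=0$, $v(N)=1$ and $v(S)\le v(T)$ whenever $S\subseteq T\subseteq N$. A coalition $S\subseteq N$ is winning if $v(S)=1$; $\mathcal{W}^v$ is the set of winning coalitions and $\mathcal{W}^v_{\min}$ the set of its inclusion-minimal elements. A coalition $B\subseteq N$ is blocking (for $N$) if $v(N\setminus B)=0$; $\mathcal{B}^v$ is the set of blocking coalitions and $\mathcal{B}^v_{\min}$ the set of its inclusion-minimal elements. The dual game $v^*$ is the simple game defined by $v^*(S)=v(N)-v(N\setminus S)$ for all $S\subseteq N$. Desirability relation: $i\succeq^v j$ iff for all $S\subseteq N\setminus\{i,j\}$, $S\cup\{j\}\in\mathcal{W}^v$ implies $S\cup\{i\}\in\mathcal{W}^v$. For real vectors, $\mathbf{x}\ge_L\mathbf{y}$ means that either $\mathbf{x}=\mathbf{y}$ or there is $k$ with $x_t=y_t$ for $t=1,\dots,k-1$ and $x_k>y_k$. LRM (Lexicographic Ranking based on Minimal winning coalitions): for $i\in N$ let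 $\theta_v(i)=(i_1,\dots,i_n)$ with $i_k=|\{S\in\mathcal{W}^v_{\min}: i\in S, |S|=k\}|$; then $R_{\mathrm{LRM}}^v$ is the total preorder on $N$ given by $i\,R_{\mathrm{LRM}}^v\,j$ iff $\theta_v(i)\ge_L\theta_v(j)$. Criticality-based ranking: for $i\in N$ let $\theta^*_v(i)=(i^*_1,\dots,i^*_n)$ with $i^*_k=|\{B\in\mathcal{B}^v_{\min}: i\in B, |B|=k\}|$; then $R_{\mathrm{crit}}^v$ is the total preorder on $N$ given by $i\,R_{\mathrm{crit}}^v\,j$ iff $\theta^*_v(i)\ge_L\theta^*_v(j)$. *)

theory Defs
  imports Complex_Main
begin

abbreviation players :: "nat \<Rightarrow> nat set" where
  "players n \<equiv> {1..n}"

text \<open>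
  Only the values of \<open>v\<close> on subsets of \<open>{1..n}\<close> matter. The integers are used as
  codomain so that the subtraction in the dual game is not truncated.
\<close>

definition simple_game :: "nat \<Rightarrow> (nat set \<Rightarrow> int) \<Rightarrow> bool" where
  "simple_game n v \<longleftrightarrow>
     (\<forall>S. S \<subseteq> players n \<longrightarrow> v S \<in> {0, 1}) \<and>
     v {} = 0 \<and> v (players n) = 1 \<and>
     (\<forall>S T. S \<subseteq> T \<and> T \<subseteq> players n \<longrightarrow> v S \<le> v T)"

definition winning :: "nat \<Rightarrow> (nat set \<Rightarrow> int) \<Rightarrow> nat set set" where
  "winning n v = {S. S \<subseteq> players n \<and> v S = 1}"

definition blocking :: "nat \<Rightarrow> (nat set \<Rightarrow> int) \<Rightarrow> nat set set" where
  "blocking n v = {B. B \<subseteq> players n \<and> v (players n - B) = 0}"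

definition minimal_sets :: "'a set set \<Rightarrow> 'a set set" where
  "minimal_sets F = {S \<in> F. \<forall>T \<in> F. T \<subseteq> S \<longrightarrow> T = S}"

definition dual_game :: "nat \<Rightarrow> (nat set \<Rightarrow> int) \<Rightarrow> nat set \<Rightarrow> int" where
  "dual_game n v S = v (players n) - v (players n - S)"

definition desirable :: "nat \<Rightarrow> (nat set \<Rightarrow> int) \<Rightarrow> nat \<Rightarrow> nat \<Rightarrow> bool" where
  "desirable n v i j \<longleftrightarrow>
     (\<forall>S. S \<subseteq> players n - {i, j} \<longrightarrow>
        S \<union> {j} \<in> winning n v \<longrightarrow> S \<union> {i} \<in> winning n v)"

text \<open>
  A vector \<open>(x\<^sub>1, \<dots>, x\<^sub>n)\<close> is a function of which only the arguments in \<open>{1..n}\<close> matter.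
\<close>

definition lex_ge :: "nat \<Rightarrow> (nat \<Rightarrow> real) \<Rightarrow> (nat \<Rightarrow> real) \<Rightarrow> bool" where
  "lex_ge n x y \<longleftrightarrow>
     (\<forall>t \<in> {1..n}. x t = y t) \<or>
     (\<exists>k \<in> {1..n}. (\<forall>t \<in> {1..<k}. x t = y t) \<and> x k > y k)"

definition theta :: "nat \<Rightarrow> (nat set \<Rightarrow> int) \<Rightarrow> nat \<Rightarrow> nat \<Rightarrow> real" where
  "theta n v i k = real (card {S \<in> minimal_sets (winning n v). i \<in> S \<and> card S = k})"

definition theta_crit :: "nat \<Rightarrow> (nat set \<Rightarrow> int) \<Rightarrow> nat \<Rightarrow> nat \<Rightarrow> real" where
  "theta_crit n v i k = real (card {B \<in> minimal_sets (blocking n v). i \<in> B \<and> card B = k})"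

definition R_LRM :: "nat \<Rightarrow> (nat set \<Rightarrow> int) \<Rightarrow> (nat \<times> nat) set" where
  "R_LRM n v = {(i, j) \<in> players n \<times> players n. lex_ge n (theta n v i) (theta n v j)}"

definition R_crit :: "nat \<Rightarrow> (nat set \<Rightarrow> int) \<Rightarrow> (nat \<times> nat) set" where
  "R_crit n v =
     {(i, j) \<in> players n \<times> players n. lex_ge n (theta_crit n v i) (theta_crit n v j)}"

lemma simple_game_dual_game:
  assumes "simple_game n v"
  shows "simple_game n (dual_game n v)"
proof -
  have bin: "v S \<in> {0, 1}" if "S \<subseteq> players n" for S
    using assms that unfolding simple_game_def by blast
  have ends: "v {} = 0" "v (players n) = 1"
    using assms unfolding simple_game_def by blast+
  have mono: "v S \<le> v T" if "S \<subseteq> T" "T \<subseteq> players n" for S T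
    using assms that unfolding simple_game_def by blast
  have "dual_game n v S \<in> {0, 1}" for S
    using bin[of "players n - S"] ends by (auto simp: dual_game_def)
  moreover have "dual_game n v S \<le> dual_game n v T" if "S \<subseteq> T" for S T
    using mono[of "players n - T" "players n - S"] that
    unfolding dual_game_def by (simp add: Diff_mono)
  ultimately show ?thesis
    using ends unfolding simple_game_def by (simp add: dual_game_def)
qed

end

theory Submission
  imports Defs "HOL-Combinatorics.Transposition"
begin

text \<open>
  If desirability is total, then the LRM coincides with it. Equally desirable players have the
  same vector, because exchanging them permutes the minimal winning coalitions. If \<open>i\<close> is strictly
  more desirable than \<open>j\<close>, take a smallest \<open>S\<close> such that \<open>S \<union> {i}\<close> wins and \<open>S \<union> {j}\<close> loses. Up to
  size \<open>card S + 1\<close> the exchange still maps minimal winning coalitions containing \<open>j\<close> to such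
  coalitions containing \<open>i\<close>, bijectively below that size and missing \<open>S \<union> {i}\<close> at that size.
  Finally, the criticality-based ranking is the LRM of the dual game, and a game and its dual have
  the same desirability relation.
\<close>

section \<open>Desirability and minimal winning coalitions, sorted by size\<close>

text \<open>Entry \<open>Suc s\<close> of \<open>theta\<close> counts coalitions made of the player
  and \<open>s\<close> others, so comparing two players there involves only the slices of
  desirability up to \<open>s\<close>.\<close>

definition desirable_at :: "nat \<Rightarrow> (nat set \<Rightarrow> int) \<Rightarrow> nat \<Rightarrow> nat \<Rightarrow> nat \<Rightarrow> bool" where
  "desirable_at n v s i j \<longleftrightarrow>
     (\<forall>S. S \<subseteq> players n - {i, j} \<longrightarrow> card S = s \<longrightarrow>
        S \<union> {j} \<in> winning n v \<longrightarrow> S \<union> {i} \<in> winning n v)"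

definition min_winning_of :: "nat \<Rightarrow> (nat set \<Rightarrow> int) \<Rightarrow> nat \<Rightarrow> nat \<Rightarrow> nat set set" where
  "min_winning_of n v i k = {S \<in> minimal_sets (winning n v). i \<in> S \<and> card S = k}"

lemma theta_eq_card: "theta n v i k = real (card (min_winning_of n v i k))"
  by (simp add: theta_def min_winning_of_def)

lemma desirable_iff_desirable_at: "desirable n v i j \<longleftrightarrow> (\<forall>s. desirable_at n v s i j)"
  by (auto simp: desirable_def desirable_at_def)

lemma finite_min_winning_of: "finite (min_winning_of n v i k)"
proof (rule finite_subset)
  show "min_winning_of n v i k \<subseteq> Pow (players n)"
    by (auto simp: min_winning_of_def minimal_sets_def winning_def)
qed simp

section \<open>Exchanging two players\<close>

lemma transpose_image_fixed:
  assumes "i \<in> S" "j \<in> S"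
  shows "transpose i j ` S = S"
  using assms by (auto simp: transpose_def image_iff)

lemma transpose_image_insert:
  assumes "i \<notin> S" "j \<notin> S"
  shows "transpose i j ` insert j S = insert i S"
proof -
  have "transpose i j x = x" if "x \<in> S" for x
    using that assms by (auto simp: transpose_def)
  then show ?thesis
    by simp
qed

text \<open>Desirability of \<open>i\<close> at size \<open>s\<close> keeps the image winning. The
  reverse relation at smaller sizes keeps it minimal: a smaller winning subset could be exchanged
  back into one properly inside \<open>S\<close>.\<close>

lemma transpose_image_min_winning_of:
  assumes at: "desirable_at n v s i j"
    and below: "\<And>r. r < s \<Longrightarrow> desirable_at n v r j i"
  shows "(`) (transpose i j) ` min_winning_of n v j (Suc s) \<subseteq> min_winning_of n v i (Suc s)"
proof (rule image_subsetI)
  fix S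
  assume S: "S \<in> min_winning_of n v j (Suc s)"
  then have win: "S \<in> winning n v" and j: "j \<in> S" and card: "card S = Suc s"
    and min: "\<And>T. T \<in> winning n v \<Longrightarrow> T \<subseteq> S \<Longrightarrow> T = S"
    by (auto simp: min_winning_of_def minimal_sets_def)
  show "transpose i j ` S \<in> min_winning_of n v i (Suc s)"
  proof (cases "i \<in> S")
    case True
    with S j show ?thesis
      by (simp add: transpose_image_fixed min_winning_of_def)
  next
    case False
    define R where "R = S - {j}"
    have SR: "S = insert j R" "j \<notin> R" "i \<notin> R"
      using j False by (auto simp: R_def)
    have fin: "finite S" and sub: "S \<subseteq> players n"
      using win finite_subset by (auto simp: winning_def)
    have R: "R \<subseteq> players n - {i, j}" "finite R" "card R = s"
      using fin sub card SR by auto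
    have "insert i R \<in> winning n v"
      using at R win SR by (simp add: desirable_at_def)
    moreover have "T = insert i R" if T: "T \<in> winning n v" "T \<subseteq> insert i R" for T
    proof (cases "i \<in> T")
      \<comment> \<open>Contradictory case: \<open>T\<close> would equal \<open>S\<close>, but
        \<open>j\<close> is not in \<open>R\<close>.\<close>
      case False
      with T SR have "T \<subseteq> R" by auto
      with T min SR show ?thesis by blast
    next
      case True
      define Q where "Q = T - {i}"
      have TQ: "T = insert i Q" "Q \<subseteq> R"
        using True T by (auto simp: Q_def)
      have "Q = R"
      proof (rule ccontr)
        assume "Q \<noteq> R"
        then have "card Q < s"
          using TQ R psubset_card_mono[of R Q] by auto
        moreover have "Q \<subseteq> players n - {j, i}"
          using TQ R by auto
        ultimately have "insert j Q \<in> winning n v"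
          using below T TQ by (auto simp: desirable_at_def)
        then have "insert j Q = S"
          using min TQ SR by blast
        moreover have "j \<notin> Q"
          using TQ SR by blast
        ultimately show False
          using SR \<open>Q \<noteq> R\<close> by (simp add: insert_ident)
      qed
      with TQ show ?thesis by simp
    qed
    moreover have "card (insert i R) = Suc s"
      using R SR by simp
    ultimately have "insert i R \<in> min_winning_of n v i (Suc s)"
      by (auto simp: min_winning_of_def minimal_sets_def)
    then show ?thesis
      using SR transpose_image_insert by simp
  qed
qed

lemma inj_image_transpose: "inj_on ((`) (transpose i j)) A"
  by (rule inj_onI) (simp only: inj_image_eq_iff[OF inj_on_transpose])

lemma theta_le_theta:
  assumes "desirable_at n v s i j" "\<And>r. r < s \<Longrightarrow> desirable_at n v r j i"
  shows "theta n v j (Suc s) \<le> theta n v i (Suc s)"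
  unfolding theta_eq_card of_nat_le_iff
  using card_inj_on_le[OF inj_image_transpose transpose_image_min_winning_of[OF assms]
      finite_min_winning_of] .

lemma theta_eq_theta:
  assumes "\<And>r. r \<le> s \<Longrightarrow> desirable_at n v r i j" "\<And>r. r \<le> s \<Longrightarrow> desirable_at n v r j i"
  shows "theta n v i (Suc s) = theta n v j (Suc s)"
  using assms by (intro antisym theta_le_theta) auto

text \<open>A witness \<open>S\<close> of the failure at size \<open>s\<close> makes
  \<open>insert i S\<close> a minimal winning coalition that the exchange misses: its only preimage
  is \<open>insert j S\<close>, which loses.\<close>

lemma theta_less_theta:
  assumes game: "simple_game n v"
    and players: "i \<in> players n" "j \<in> players n"
    and at: "desirable_at n v s i j" and not_at: "\<not> desirable_at n v s j i"
    and below: "\<And>r. r < s \<Longrightarrow> desirable_at n v r j i"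
  shows "theta n v j (Suc s) < theta n v i (Suc s)"
proof -
  let ?f = "(`) (transpose i j)"
  have upward: "T \<in> winning n v" if "S \<in> winning n v" "S \<subseteq> T" "T \<subseteq> players n" for S T
  proof -
    have "v S \<le> v T" "v T \<in> {0, 1}"
      using game that unfolding simple_game_def by blast+
    then show ?thesis
      using that by (auto simp: winning_def)
  qed
  obtain S where S: "S \<subseteq> players n - {i, j}" "card S = s"
    and win: "insert i S \<in> winning n v" and lose: "insert j S \<notin> winning n v"
    using not_at by (auto simp: desirable_at_def)
  have fin: "finite S"
    using S finite_subset by auto
  have jS: "insert j S \<subseteq> players n"
    using S players by auto
  have "i \<noteq> j"
    using win lose by auto
  \<comment> \<open>A winning \<open>T\<close> properly inside \<open>insert i S\<close> would,
    directly or after replacing \<open>i\<close> by \<open>j\<close>, be a winning subset of the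
    losing \<open>insert j S\<close>.\<close>
  have "T = insert i S" if T: "T \<in> winning n v" "T \<subseteq> insert i S" for T
  proof -
    define Q where "Q = T - {i}"
    have Q: "Q \<subseteq> S"
      using T by (auto simp: Q_def)
    have "i \<in> T"
    proof (rule ccontr)
      assume "i \<notin> T"
      with T have "T \<subseteq> insert j S" by auto
      with upward T jS lose show False by blast
    qed
    then have TQ: "T = insert i Q"
      by (auto simp: Q_def)
    have "Q = S"
    proof (rule ccontr)
      assume "Q \<noteq> S"
      then have "card Q < s"
        using Q S fin psubset_card_mono[of S Q] by auto
      moreover have "Q \<subseteq> players n - {j, i}"
        using Q S by auto
      ultimately have "insert j Q \<in> winning n v"
        using below T TQ by (auto simp: desirable_at_def)
      then show False
        using upward[of "insert j Q" "insert j S"] Q jS lose by blast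
    qed
    with TQ show ?thesis by simp
  qed
  moreover have "card (insert i S) = Suc s"
    using S fin by (subst card_insert_disjoint) auto
  ultimately have "insert i S \<in> min_winning_of n v i (Suc s)"
    using win by (auto simp: min_winning_of_def minimal_sets_def)
  moreover have "insert i S \<notin> ?f ` min_winning_of n v j (Suc s)"
  proof
    assume "insert i S \<in> ?f ` min_winning_of n v j (Suc s)"
    then obtain T where T: "T \<in> min_winning_of n v j (Suc s)" "insert i S = ?f T"
      by auto
    have "?f T = ?f (insert j S)"
      unfolding T(2)[symmetric] using S by (intro transpose_image_insert[symmetric]) auto
    then have "T = insert j S"
      by (rule inj_onD[OF inj_image_transpose[of i j UNIV]]) simp_all
    with T lose show False
      by (auto simp: min_winning_of_def minimal_sets_def)
  qed
  ultimately have "?f ` min_winning_of n v j (Suc s) \<subset> min_winning_of n v i (Suc s)"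
    using transpose_image_min_winning_of[OF at below] by blast
  then have "card (?f ` min_winning_of n v j (Suc s)) < card (min_winning_of n v i (Suc s))"
    by (rule psubset_card_mono[OF finite_min_winning_of])
  then show ?thesis
    by (simp add: theta_eq_card card_image[OF inj_image_transpose])
qed

section \<open>Lexicographic comparison of the vectors\<close>

lemma lex_ge_theta_if_equally_desirable:
  assumes "desirable n v i j" "desirable n v j i"
  shows "lex_ge n (theta n v i) (theta n v j)"
proof -
  \<comment> \<open>Size \<open>t - 1\<close> belongs to entry \<open>t\<close>; as
    \<open>t \<ge> 1\<close>, nothing is truncated.\<close>
  have "theta n v i t = theta n v j t" if "t \<in> {1..n}" for t
    using theta_eq_theta[of "t - 1" n v i j] assms that by (simp add: desirable_iff_desirable_at)
  then show ?thesis
    by (simp add: lex_ge_def)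
qed

lemma lex_ge_theta_if_strictly_desirable:
  assumes game: "simple_game n v"
    and players: "i \<in> players n" "j \<in> players n"
    and des: "desirable n v i j" and not_des: "\<not> desirable n v j i"
  shows "lex_ge n (theta n v i) (theta n v j) \<and> \<not> lex_ge n (theta n v j) (theta n v i)"
proof -
  \<comment> \<open>The first size at which the reverse desirability fails; the vectors first differ
    at entry \<open>Suc s\<close>.\<close>
  define s where "s = (LEAST s. \<not> desirable_at n v s j i)"
  have not_at: "\<not> desirable_at n v s j i"
    using not_des unfolding desirable_iff_desirable_at s_def not_all by (rule LeastI_ex)
  have below: "desirable_at n v r j i" if "r < s" for r
    using not_less_Least that unfolding s_def by blast
  have at: "desirable_at n v r i j" for r
    using des by (simp add: desirable_iff_desirable_at)
  have less: "theta n v j (Suc s) < theta n v i (Suc s)"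
    using theta_less_theta[OF game players at not_at below] .
  have eq: "theta n v i t = theta n v j t" if "t \<in> {1..<Suc s}" for t
  proof -
    have "theta n v i (Suc (t - 1)) = theta n v j (Suc (t - 1))"
      using that by (intro theta_eq_theta at below) auto
    then show ?thesis
      using that by simp
  qed
  \<comment> \<open>The witness avoids \<open>i\<close>, so \<open>s \<le> n - 1\<close> and
    \<open>Suc s\<close> is a valid index.\<close>
  obtain S where "S \<subseteq> players n - {i}" "card S = s"
    using not_at by (auto simp: desirable_at_def)
  then have "s \<le> card (players n - {i})"
    using card_mono[of "players n - {i}" S] by auto
  then have range: "Suc s \<in> {1..n}"
    using players by auto
  \<comment> \<open>No \<open>k\<close> favours \<open>j\<close>: entries before
    \<open>Suc s\<close> agree, entry \<open>Suc s\<close> favours \<open>i\<close>, and a later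
    \<open>k\<close> would require equality at \<open>Suc s\<close>.\<close>
  have "\<not> (\<exists>k \<in> {1..n}. (\<forall>t \<in> {1..<k}. theta n v j t = theta n v i t)
      \<and> theta n v j k > theta n v i k)"
  proof
    assume "\<exists>k \<in> {1..n}. (\<forall>t \<in> {1..<k}. theta n v j t = theta n v i t)
      \<and> theta n v j k > theta n v i k"
    then obtain k where k: "k \<in> {1..n}" "\<forall>t \<in> {1..<k}. theta n v j t = theta n v i t"
      "theta n v j k > theta n v i k"
      by blast
    consider "k < Suc s" | "k = Suc s" | "Suc s < k"
      by linarith
    then show False
      using k eq[of k] less by cases auto
  qed
  moreover have "\<not> (\<forall>t \<in> {1..n}. theta n v j t = theta n v i t)"
    using range less by force
  ultimately show ?thesis
    using range less eq unfolding lex_ge_def by blast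
qed

text \<open>By totality, if \<open>i\<close> is not desirable over \<open>j\<close>, then
  \<open>j\<close> is strictly more desirable, and the strict case excludes \<open>lex_ge\<close>
  for the pair \<open>(i, j)\<close>.\<close>

lemma R_LRM_eq_desirable:
  assumes "simple_game n v"
    and "\<forall>i \<in> players n. \<forall>j \<in> players n. desirable n v i j \<or> desirable n v j i"
  shows "R_LRM n v = {(i, j) \<in> players n \<times> players n. desirable n v i j}"
proof -
  have "lex_ge n (theta n v i) (theta n v j) \<longleftrightarrow> desirable n v i j"
    if "i \<in> players n" "j \<in> players n" for i j
    using lex_ge_theta_if_equally_desirable lex_ge_theta_if_strictly_desirable assms that by blast
  then show ?thesis
    by (auto simp: R_LRM_def)
qed

section \<open>Duality\<close>

lemma winning_dual_game:
  assumes "simple_game n v"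
  shows "winning n (dual_game n v) = blocking n v"
  using assms by (auto simp: winning_def blocking_def dual_game_def simple_game_def)

text \<open>Phrased with winning coalitions because the double dual is only known to agree with
  \<open>v\<close> on subsets of \<open>players n\<close>.\<close>

lemma winning_dual_game_dual_game:
  assumes "simple_game n v"
  shows "winning n (dual_game n (dual_game n v)) = winning n v"
proof -
  have "dual_game n (dual_game n v) S = v S" if "S \<subseteq> players n" for S
    using assms that by (simp add: dual_game_def simple_game_def double_diff)
  then show ?thesis
    by (auto simp: winning_def)
qed

lemma R_crit_eq_R_LRM_dual_game:
  assumes "simple_game n v"
  shows "R_crit n v = R_LRM n (dual_game n v)"
proof -
  have "theta_crit n v = theta n (dual_game n v)"
    by (intro ext) (simp add: theta_def theta_crit_def winning_dual_game[OF assms])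
  then show ?thesis
    by (simp add: R_LRM_def R_crit_def)
qed

text \<open>Complements reverse the exchange: if \<open>S \<union> {i}\<close> failed to block, its
  complement \<open>U \<union> {j}\<close> would win, hence also \<open>U \<union> {i}\<close>, the
  complement of \<open>S \<union> {j}\<close>.\<close>

lemma desirable_dual_game:
  assumes game: "simple_game n v"
    and players: "i \<in> players n" "j \<in> players n"
    and des: "desirable n v i j"
  shows "desirable n (dual_game n v) i j"
\<comment> \<open>The complement of \<open>S \<union> {j}\<close> contains \<open>i\<close> only if
  the players are distinct.\<close>
proof (cases "i = j")
  case True
  then show ?thesis
    by (simp add: desirable_def)
next
  case False
  have bin: "v S = 0 \<or> v S = 1" if "S \<subseteq> players n" for S
    using game that unfolding simple_game_def by blast
  show ?thesis
    unfolding desirable_def winning_dual_game[OF game]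
  proof (intro allI impI)
    fix S
    assume S: "S \<subseteq> players n - {i, j}" and block: "S \<union> {j} \<in> blocking n v"
    define U where "U = players n - S - {i, j}"
    have U: "players n - (S \<union> {j}) = U \<union> {i}" "players n - (S \<union> {i}) = U \<union> {j}"
      using S False players by (auto simp: U_def)
    have sub: "U \<subseteq> players n - {i, j}" "U \<union> {j} \<subseteq> players n"
      using players by (auto simp: U_def)
    have "U \<union> {i} \<notin> winning n v"
      using block unfolding blocking_def winning_def mem_Collect_eq U(1) by simp
    then have "U \<union> {j} \<notin> winning n v"
      using des sub unfolding desirable_def by blast
    then have "v (U \<union> {j}) = 0"
      using bin sub unfolding winning_def by blast
    then show "S \<union> {i} \<in> blocking n v"
      using S players unfolding blocking_def mem_Collect_eq U(2) by auto
  qed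
qed

text \<open>The converse is the forward direction for the dual game, whose own dual has the winning
  coalitions of \<open>v\<close>.\<close>

lemma desirable_dual_game_iff:
  assumes "simple_game n v" "i \<in> players n" "j \<in> players n"
  shows "desirable n (dual_game n v) i j \<longleftrightarrow> desirable n v i j"
proof
  assume "desirable n (dual_game n v) i j"
  then have "desirable n (dual_game n (dual_game n v)) i j"
    by (rule desirable_dual_game[OF simple_game_dual_game[OF assms(1)] assms(2,3)])
  then show "desirable n v i j"
    unfolding desirable_def winning_dual_game_dual_game[OF assms(1)] .
qed (rule desirable_dual_game[OF assms])

theorem corollary1:
  fixes n :: nat and v :: "nat set \<Rightarrow> int"
  assumes "simple_game n v"
    and "\<forall>i \<in> players n. \<forall>j \<in> players n. desirable n v i j \<or> desirable n v j i"
  shows "R_LRM n v = R_crit n v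
    \<and> R_LRM n v = R_LRM n (dual_game n v)
    \<and> R_crit n v = R_crit n (dual_game n v)"
proof -
  note dual = simple_game_dual_game[OF assms(1)]
  \<comment> \<open>Totality passes to the dual, so both games have an LRM equal to their common
    desirability relation.\<close>
  have "\<forall>i \<in> players n. \<forall>j \<in> players n.
      desirable n (dual_game n v) i j \<or> desirable n (dual_game n v) j i"
    using assms desirable_dual_game by blast
  then have LRM: "R_LRM n (dual_game n v) = R_LRM n v"
    using R_LRM_eq_desirable assms dual desirable_dual_game_iff[OF assms(1)] by auto
  \<comment> \<open>The left side is \<open>R_crit\<close> of the dual game.\<close>
  have "R_LRM n (dual_game n (dual_game n v)) = R_LRM n v"
    unfolding R_LRM_def theta_def winning_dual_game_dual_game[OF assms(1)] ..
  then show ?thesis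
    using LRM R_crit_eq_R_LRM_dual_game assms(1) dual by simp
qed

end
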